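(* Let $\eta>0$, and let $M$, $K$, $m$ be the mass matrix, stiffness matrix and mean-value vector of the piecewise linear finite element space described in the context, with $\bar K=K+mm^T$. Let $$S=\eta\bar K+M\bar K^{-1}M,\qquad S_{\mathrm{pre}}=(M+\sqrt\eta\,\bar K)\,\bar K^{-1}\,(M+\sqrt\eta\,\bar K).$$ Then $$\kappa(S_{\mathrm{pre}}^{-1}S)<2.$$
   Context: Let $\Omega=(0,1)\times(0,1)$, let $\mathcal{T}_h$ be a triangulation of $\Omega$ with node set $\mathcal{N}_h$, $n=|\mathcal{N}_h|$, and let $(\lambda_p)_{p\in\mathcal{N}_h}$ be the nodal basis of the space of continuous functions on $\bar\Omega$ that are linear on each triangle (no boundary conditions imposed). The mass matrix is $M=(\int_\Omega \lambda_p\lambda_q\,dx)_{p,q}$, the stiffness matrix is $K=(\int_\Omega \nabla\lambda_p\cdot\nabla\lambda_q\,dx)_{p,q}$, and $m=(\int_\Omega\lambda_p\,dx)_p\in\mathbb{R}^n$. The parameter is $\eta=\epsilon\tau>0$. For a nonsingular matrix $Z$ with real eigenvalues, the condition number is $\kappa(Z)=\max|\lambda(Z)|/\min|\lambda(Z)|$, the maximum and minimum being over all eigenvalues $\lambda(Z)$ of $Z$. *)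

theory Defs
  imports
    "HOL-Analysis.Analysis"
    "Jordan_Normal_Form.Gauss_Jordan_Elimination"
    "Jordan_Normal_Form.Spectral_Radius"
begin

definition Omega :: "(real \<times> real) set" where
  "Omega = {0<..<1} \<times> {0<..<1}"

text \<open>The library's \<^const>\<open>triangulation\<close> supplies finiteness and conformity: any two of the closed
  simplices meet in a common face of both (possibly empty).\<close>

definition triangulation_of :: "(real \<times> real) set set \<Rightarrow> (real \<times> real) set \<Rightarrow> bool" where
  "triangulation_of \<T> D \<longleftrightarrow>
     triangulation \<T> \<and> (\<forall>T\<in>\<T>. 2 simplex T) \<and> \<Union>\<T> = closure D"

definition mesh_nodes :: "(real \<times> real) set set \<Rightarrow> (real \<times> real) set" where
  "mesh_nodes \<T> = {p. \<exists>T\<in>\<T>. p extreme_point_of T}"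

definition P1_space :: "(real \<times> real) set set \<Rightarrow> (real \<times> real \<Rightarrow> real) set" where
  "P1_space \<T> = {v. continuous_on (\<Union>\<T>) v \<and>
                     (\<forall>T\<in>\<T>. \<exists>a b. \<forall>x\<in>T. v x = inner a x + b)}"

text \<open>The conditions determine each \<open>\<phi> p\<close> (for a node \<open>p\<close>) on the whole mesh; its values off the
  mesh are irrelevant below, where all integrals are over the open square \<^const>\<open>Omega\<close>.\<close>

definition nodal_basis ::
    "(real \<times> real) set set \<Rightarrow> (real \<times> real \<Rightarrow> real \<times> real \<Rightarrow> real) \<Rightarrow> bool" where
  "nodal_basis \<T> \<phi> \<longleftrightarrow>
     (\<forall>p\<in>mesh_nodes \<T>. \<phi> p \<in> P1_space \<T> \<and>
        (\<forall>q\<in>mesh_nodes \<T>. \<phi> p q = (if p = q then 1 else 0)))"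

text \<open>Piecewise linear functions are differentiable in the interior of every triangle. The value of
  \<open>gradient\<close> at points of non-differentiability is unspecified; these lie on the
  triangle edges, a Lebesgue null set.\<close>

definition gradient :: "('a::real_inner \<Rightarrow> real) \<Rightarrow> 'a \<Rightarrow> 'a" where
  "gradient f x = (THE D. GDERIV f x :> D)"

text \<open>Matrices are indexed by positions in a list \<open>ps\<close> enumerating the nodes.\<close>

definition mass_matrix ::
    "(real \<times> real \<Rightarrow> real \<times> real \<Rightarrow> real) \<Rightarrow> (real \<times> real) list \<Rightarrow> real mat" where
  "mass_matrix \<phi> ps = Matrix.mat (length ps) (length ps)
     (\<lambda>(i, j). LINT x:Omega|lebesgue. \<phi> (ps ! i) x * \<phi> (ps ! j) x)"

definition stiffness_matrix ::
    "(real \<times> real \<Rightarrow> real \<times> real \<Rightarrow> real) \<Rightarrow> (real \<times> real) list \<Rightarrow> real mat" where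
  "stiffness_matrix \<phi> ps = Matrix.mat (length ps) (length ps)
     (\<lambda>(i, j). LINT x:Omega|lebesgue. inner (gradient (\<phi> (ps ! i)) x) (gradient (\<phi> (ps ! j)) x))"

definition mean_vector ::
    "(real \<times> real \<Rightarrow> real \<times> real \<Rightarrow> real) \<Rightarrow> (real \<times> real) list \<Rightarrow> real Matrix.vec" where
  "mean_vector \<phi> ps = Matrix.vec (length ps) (\<lambda>i. LINT x:Omega|lebesgue. \<phi> (ps ! i) x)"

definition outer_product :: "real Matrix.vec \<Rightarrow> real Matrix.vec \<Rightarrow> real mat" where
  "outer_product u v = Matrix.mat (dim_vec u) (dim_vec v) (\<lambda>(i, j). vec_index u i * vec_index v j)"

text \<open>Meaningful only when \<open>A\<close> is invertible.\<close>

definition inv_mat :: "real mat \<Rightarrow> real mat" where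
  "inv_mat A = the (mat_inverse A)"

definition complex_spectrum :: "real mat \<Rightarrow> complex set" where
  "complex_spectrum Z = spectrum (map_mat complex_of_real Z)"

text \<open>Intended for nonsingular matrices all of whose (complex) eigenvalues are real.\<close>

definition eig_cond :: "real mat \<Rightarrow> real" where
  "eig_cond Z = Max (cmod ` complex_spectrum Z) / Min (cmod ` complex_spectrum Z)"

end

theory Submission
  imports Defs
begin

text \<open>
  Write \<open>s = sqrt \<eta>\<close>. Multiplying out, \<open>Spre\<close> equals \<open>S + 2 s M\<close>, while
  \<open>2 S - Spre = S - 2 s M\<close> is the product of \<open>M - s Kbar\<close>, the inverse of \<open>Kbar\<close> and
  \<open>M - s Kbar\<close> again. If \<open>M\<close> and \<open>Kbar\<close> are symmetric positive definite, then so is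
  \<open>Spre - S\<close>, and \<open>2 S - Spre\<close> is positive semidefinite. An eigenvalue of \<open>inv_mat Spre * S\<close>
  is a quotient of the forms of \<open>S\<close> and \<open>Spre\<close> at a real vector (\<open>pencil_eigenvalue_real\<close>),
  so it lies in \<open>[1/2, 1)\<close>. The spectrum is finite, hence its maximum is still below 1, and the
  condition number is below 2 (\<open>preconditioned_schur_complement\<close>).

  It remains to see that \<open>M\<close> and \<open>Kbar\<close> are positive definite. For a finite element function
  \<open>u\<close> with coefficient vector \<open>c\<close>, the form of \<open>M\<close> at \<open>c\<close> is the integral of \<open>u\<^sup>2\<close>, and
  the form of \<open>Kbar\<close> is the integral of the squared gradient plus the squared mean of \<open>u\<close>. If
  the first vanishes, then \<open>u = 0\<close> by continuity, and \<open>c = 0\<close> because \<open>c\<close> lists the nodal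
  values (\<open>mass_matrix_spd\<close>). If the second vanishes, then \<open>u\<close> is constant on each triangle,
  hence constant on the connected square, and zero by its mean
  (\<open>stabilized_stiffness_spd\<close>). The measure-theoretic work lies in the gradients, which are
  controlled only inside the triangles: edges are null sets (\<open>AE_triangle_interior\<close>).
\<close>

section \<open>Symmetric positive definite matrices\<close>

text \<open>Symmetry is part of the notion: it makes the eigenvalues of a symmetric pencil real and is
  inherited by inverses and by the sandwich products below.\<close>

definition spd_mat :: "nat \<Rightarrow> real mat \<Rightarrow> bool" where
  "spd_mat n A \<longleftrightarrow> A \<in> carrier_mat n n \<and> transpose_mat A = A \<and>
     (\<forall>x\<in>carrier_vec n. x \<noteq> 0\<^sub>v n \<longrightarrow> 0 < scalar_prod x (A *\<^sub>v x))"

lemma spd_matD: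
  assumes "spd_mat n A"
  shows "A \<in> carrier_mat n n" "transpose_mat A = A"
    "\<And>x. x \<in> carrier_vec n \<Longrightarrow> x \<noteq> 0\<^sub>v n \<Longrightarrow> 0 < scalar_prod x (A *\<^sub>v x)"
  using assms by (auto simp: spd_mat_def)

lemma spd_mat_nonneg:
  assumes "spd_mat n A" "x \<in> carrier_vec n"
  shows "0 \<le> scalar_prod x (A *\<^sub>v x)"
  using spd_matD[OF assms(1)] assms(2) by (cases "x = 0\<^sub>v n") (auto intro: less_imp_le)

lemma symmetric_mat_scalar_prod:
  fixes A :: "real mat"
  assumes "A \<in> carrier_mat n n" "transpose_mat A = A" "x \<in> carrier_vec n" "y \<in> carrier_vec n"
  shows "scalar_prod (A *\<^sub>v x) y = scalar_prod x (A *\<^sub>v y)"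
  using transpose_vec_mult_scalar[of A n n y x] assms by simp

lemma inv_mat_det:
  assumes A: "A \<in> carrier_mat n n" and det: "det A \<noteq> 0"
  shows "inv_mat A \<in> carrier_mat n n" "A * inv_mat A = 1\<^sub>m n" "inv_mat A * A = 1\<^sub>m n"
proof -
  have "A \<in> Units (ring_mat TYPE(real) n ())"
    using det_non_zero_imp_unit[OF A det] .
  then obtain B where "mat_inverse A = Some B"
    using mat_inverse(1)[OF A, where b = "()"] by (cases "mat_inverse A") auto
  then show "inv_mat A \<in> carrier_mat n n" "A * inv_mat A = 1\<^sub>m n" "inv_mat A * A = 1\<^sub>m n"
    using mat_inverse(2)[OF A, of B] by (auto simp: inv_mat_def)
qed

lemma invertible_matI:
  assumes "A \<in> carrier_mat n n" "B \<in> carrier_mat n n" "A * B = 1\<^sub>m n" "B * A = 1\<^sub>m n"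
  shows "invertible_mat A"
  using assms by (auto simp: invertible_mat_def inverts_mat_def square_mat.simps)

text \<open>A kernel vector would make the quadratic form vanish.\<close>

lemma spd_mat_det:
  assumes "spd_mat n A"
  shows "det A \<noteq> 0"
proof
  assume "det A = 0"
  then obtain x where "x \<in> carrier_vec n" "x \<noteq> 0\<^sub>v n" "A *\<^sub>v x = 0\<^sub>v n"
    using det_0_iff_vec_prod_zero_field[OF spd_matD(1)[OF assms]] by auto
  with spd_matD(3)[OF assms, of x] show False by simp
qed

lemmas spd_mat_inverse = inv_mat_det[OF spd_matD(1) spd_mat_det]

lemma spd_mat_invertible:
  assumes "spd_mat n A"
  shows "invertible_mat A"
  by (rule invertible_matI[OF spd_matD(1)[OF assms] spd_mat_inverse[OF assms assms]])

text \<open>Substituting \<open>x = A w\<close> turns the quadratic form of the inverse at \<open>x\<close> into that of \<open>A\<close>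
  at \<open>w\<close>; the inverse is symmetric because its transpose is also a left inverse of \<open>A\<close>.\<close>

lemma spd_mat_inv_mat:
  assumes A: "spd_mat n A"
  shows "spd_mat n (inv_mat A)"
proof -
  let ?B = "inv_mat A"
  note cA = spd_matD(1)[OF A] and sA = spd_matD(2)[OF A]
  note B = spd_mat_inverse[OF A A]
  have cT: "transpose_mat ?B \<in> carrier_mat n n" using B(1) by simp
  have "transpose_mat ?B * A = transpose_mat (A * ?B)"
    using cA B(1) sA by (simp add: transpose_mult)
  then have l: "transpose_mat ?B * A = 1\<^sub>m n" using B(2) by simp
  have "transpose_mat ?B = transpose_mat ?B * (A * ?B)" using B(2) cT by simp
  also have "\<dots> = (transpose_mat ?B * A) * ?B"
    using cT cA B(1) by (simp add: assoc_mult_mat)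
  also have "\<dots> = ?B" using l B(1) by simp
  finally have s: "transpose_mat ?B = ?B" .
  have "0 < scalar_prod x (?B *\<^sub>v x)" if x: "x \<in> carrier_vec n" "x \<noteq> 0\<^sub>v n" for x
  proof -
    let ?w = "?B *\<^sub>v x"
    have w: "?w \<in> carrier_vec n" using B(1) x by simp
    have Aw: "A *\<^sub>v ?w = x"
      using x B cA by (simp flip: assoc_mult_mat_vec)
    moreover have "A *\<^sub>v 0\<^sub>v n = 0\<^sub>v n" using cA by auto
    ultimately have "?w \<noteq> 0\<^sub>v n" using x(2) by metis
    then have "0 < scalar_prod ?w (A *\<^sub>v ?w)" using spd_matD(3)[OF A w] by simp
    also have "\<dots> = scalar_prod x ?w"
      using Aw comm_scalar_prod[OF w x(1)] by simp
    finally show ?thesis .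
  qed
  with s B(1) show ?thesis by (auto simp: spd_mat_def)
qed

lemma smult_mult_mat_vec:
  fixes A :: "real mat"
  assumes "A \<in> carrier_mat n n" "x \<in> carrier_vec n"
  shows "(c \<cdot>\<^sub>m A) *\<^sub>v x = c \<cdot>\<^sub>v (A *\<^sub>v x)"
  using assms by (auto simp: scalar_prod_def sum_distrib_left mult.assoc intro!: eq_vecI)

lemma transpose_smult_mat: "transpose_mat (c \<cdot>\<^sub>m A) = c \<cdot>\<^sub>m transpose_mat A"
  by (intro eq_matI) auto

lemma spd_mat_add_smult:
  assumes A: "spd_mat n A" and B: "spd_mat n B" and c: "c > 0"
  shows "spd_mat n (A + c \<cdot>\<^sub>m B)"
proof -
  note cA = spd_matD(1)[OF A] and cB = spd_matD(1)[OF B]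
  have "scalar_prod x ((A + c \<cdot>\<^sub>m B) *\<^sub>v x)
      = scalar_prod x (A *\<^sub>v x) + c * scalar_prod x (B *\<^sub>v x)" if "x \<in> carrier_vec n" for x
    using that cA cB
    by (simp add: add_mult_distrib_mat_vec[of _ n n] smult_mult_mat_vec[of _ n]
        scalar_prod_add_distrib[of _ n])
  then show ?thesis
    using cA cB spd_matD(2)[OF A] spd_matD(2)[OF B] c spd_matD(3)[OF A] spd_matD(3)[OF B]
    by (auto simp: spd_mat_def transpose_add[of _ n n] transpose_smult_mat add_pos_pos)
qed

text \<open>Moving the outer symmetric factor to the other side reduces forms of type \<open>X W X\<close>, such
  as the preconditioner, to the form of the inner factor.\<close>

lemma sandwich_mat:
  fixes X W :: "real mat"
  assumes X: "X \<in> carrier_mat n n" "transpose_mat X = X"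
    and W: "W \<in> carrier_mat n n" and x: "x \<in> carrier_vec n"
  shows "scalar_prod x ((X * W * X) *\<^sub>v x) = scalar_prod (X *\<^sub>v x) (W *\<^sub>v (X *\<^sub>v x))"
  using symmetric_mat_scalar_prod[OF X x, of "W *\<^sub>v (X *\<^sub>v x)"] X W x
  by (simp add: assoc_mult_mat_vec[of _ n n _ n] mult_carrier_mat[of _ n n _ n])

section \<open>Eigenvalues of a symmetric pencil\<close>

lemma map_vec_Re_Im_mult:
  fixes A :: "real mat"
  assumes "A \<in> carrier_mat n n" "v \<in> carrier_vec n"
  shows "map_vec Re (map_mat complex_of_real A *\<^sub>v v) = A *\<^sub>v map_vec Re v"
    "map_vec Im (map_mat complex_of_real A *\<^sub>v v) = A *\<^sub>v map_vec Im v"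
  using assms by (auto simp: scalar_prod_def intro!: eq_vecI sum.cong)

text \<open>The spectrum of \<open>inv_mat P * S\<close> is defined with complex eigenvectors. If \<open>x + iy\<close> is one, the
  real and imaginary parts of the eigenvalue equation read
  \<open>S x = Re z P x - Im z P y\<close> and \<open>S y = Im z P x + Re z P y\<close>. Pairing the first with \<open>y\<close> and
  the second with \<open>x\<close> and subtracting, the symmetry of \<open>S\<close> and \<open>P\<close> leaves
  \<open>Im z (x\<cdot>P x + y\<cdot>P y) = 0\<close>, so \<open>z\<close> is real, and then \<open>x\<close> or \<open>y\<close> is a real eigenvector.
  Either way \<open>z\<close> is a Rayleigh quotient.\<close>

lemma pencil_eigenvalue_real:
  assumes P: "spd_mat n P" and S: "S \<in> carrier_mat n n" "transpose_mat S = S"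
    and z: "z \<in> complex_spectrum (inv_mat P * S)"
  obtains x where "x \<in> carrier_vec n" "x \<noteq> 0\<^sub>v n" "z \<in> \<real>"
    "scalar_prod x (S *\<^sub>v x) = Re z * scalar_prod x (P *\<^sub>v x)"
proof -
  define Z where "Z = inv_mat P * S"
  note cP = spd_matD(1)[OF P] and sP = spd_matD(2)[OF P]
  note Q = spd_mat_inverse[OF P P]
  have cZ: "Z \<in> carrier_mat n n" unfolding Z_def using Q(1) S(1) by simp
  have PZ: "P *\<^sub>v (Z *\<^sub>v x) = S *\<^sub>v x" if "x \<in> carrier_vec n" for x
  proof -
    have "P * Z = (P * inv_mat P) * S"
      unfolding Z_def using assoc_mult_mat[OF cP Q(1) S(1)] by simp
    then have "P * Z = S" using Q(2) S(1) by simp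
    then show ?thesis using that cP cZ by (metis assoc_mult_mat_vec)
  qed
  from z obtain v where v: "v \<in> carrier_vec n" "v \<noteq> 0\<^sub>v n"
    and ev: "map_mat complex_of_real Z *\<^sub>v v = z \<cdot>\<^sub>v v"
    using cZ unfolding complex_spectrum_def spectrum_def eigenvalue_def eigenvector_def Z_def
    by auto
  define x where "x = map_vec Re v"
  define y where "y = map_vec Im v"
  have cx: "x \<in> carrier_vec n" and cy: "y \<in> carrier_vec n" using v by (auto simp: x_def y_def)
  have Zx: "Z *\<^sub>v x = Re z \<cdot>\<^sub>v x - Im z \<cdot>\<^sub>v y"
    unfolding x_def using v(1)
    by (subst map_vec_Re_Im_mult(1)[OF cZ v(1), symmetric], subst ev)
      (auto simp: y_def intro!: eq_vecI)
  have Zy: "Z *\<^sub>v y = Im z \<cdot>\<^sub>v x + Re z \<cdot>\<^sub>v y"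
    unfolding y_def using v(1)
    by (subst map_vec_Re_Im_mult(2)[OF cZ v(1), symmetric], subst ev)
      (auto simp: x_def intro!: eq_vecI)
  have Sx: "S *\<^sub>v x = Re z \<cdot>\<^sub>v (P *\<^sub>v x) - Im z \<cdot>\<^sub>v (P *\<^sub>v y)"
    unfolding PZ[OF cx, symmetric] Zx using cx cy cP
    by (simp add: mult_minus_distrib_mat_vec[of _ n n] mult_mat_vec[of _ n n])
  have Sy: "S *\<^sub>v y = Im z \<cdot>\<^sub>v (P *\<^sub>v x) + Re z \<cdot>\<^sub>v (P *\<^sub>v y)"
    unfolding PZ[OF cy, symmetric] Zy using cx cy cP
    by (simp add: mult_add_distrib_mat_vec[of _ n n] mult_mat_vec[of _ n n])
  have c: "P *\<^sub>v x \<in> carrier_vec n" "P *\<^sub>v y \<in> carrier_vec n" using cP cx cy by auto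
  have swap: "scalar_prod x (A *\<^sub>v y) = scalar_prod y (A *\<^sub>v x)"
    if "A \<in> carrier_mat n n" "transpose_mat A = A" for A
    using symmetric_mat_scalar_prod[OF that cx cy] comm_scalar_prod[of "A *\<^sub>v x" n y] that cx cy
    by simp
  have "scalar_prod y (S *\<^sub>v x) = Re z * scalar_prod y (P *\<^sub>v x) - Im z * scalar_prod y (P *\<^sub>v y)"
    unfolding Sx using c cx cy by (simp add: scalar_prod_minus_distrib[of _ n])
  moreover have "scalar_prod x (S *\<^sub>v y) = Im z * scalar_prod x (P *\<^sub>v x) + Re z * scalar_prod x (P *\<^sub>v y)"
    unfolding Sy using c cx cy by (simp add: scalar_prod_add_distrib[of _ n])
  ultimately have im: "Im z * (scalar_prod x (P *\<^sub>v x) + scalar_prod y (P *\<^sub>v y)) = 0"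
    using swap[OF cP sP] swap[OF S] by (simp add: algebra_simps)
  have nz: "x \<noteq> 0\<^sub>v n \<or> y \<noteq> 0\<^sub>v n"
  proof (rule ccontr)
    assume "\<not> ?thesis"
    then have xy: "x = 0\<^sub>v n" "y = 0\<^sub>v n" by auto
    have "vec_index v i = 0" if "i < n" for i
      using that v(1) arg_cong[OF xy(1), of "\<lambda>u. vec_index u i"]
        arg_cong[OF xy(2), of "\<lambda>u. vec_index u i"]
      by (auto simp: x_def y_def complex_eq_iff)
    with v show False by (auto intro: eq_vecI)
  qed
  have "0 < scalar_prod x (P *\<^sub>v x) + scalar_prod y (P *\<^sub>v y)"
    using nz spd_mat_nonneg[OF P cx] spd_mat_nonneg[OF P cy] spd_matD(3)[OF P cx]
      spd_matD(3)[OF P cy]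
    by (auto intro: add_pos_nonneg add_nonneg_pos)
  with im have im0: "Im z = 0" by auto
  then have re: "z \<in> \<real>" by (simp add: complex_is_Real_iff)
  have "scalar_prod x (S *\<^sub>v x) = Re z * scalar_prod x (P *\<^sub>v x)"
    "scalar_prod y (S *\<^sub>v y) = Re z * scalar_prod y (P *\<^sub>v y)"
    unfolding Sx Sy im0 using c cx cy
    by (simp_all add: scalar_prod_add_distrib[of _ n] scalar_prod_minus_distrib[of _ n])
  with nz re cx cy that show thesis by blast
qed

text \<open>The strict upper bound survives passing to the maximum because the spectrum is finite, and the
  maximum exists because it is nonempty, which needs a matrix of positive size.\<close>

lemma eig_cond_bound:
  assumes Z: "Z \<in> carrier_mat n n" and n: "0 < n" and l: "0 < l"
    and bd: "\<And>z. z \<in> complex_spectrum Z \<Longrightarrow> l \<le> cmod z \<and> cmod z < r"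
  shows "eig_cond Z < r / l"
proof -
  have cZ: "map_mat complex_of_real Z \<in> carrier_mat n n" using Z by simp
  let ?N = "cmod ` complex_spectrum Z"
  have fin: "finite ?N" and ne: "?N \<noteq> {}"
    using card_finite_spectrum(1)[OF cZ] spectrum_non_empty[OF cZ n]
    by (auto simp: complex_spectrum_def)
  have mx: "Max ?N < r" and mn: "l \<le> Min ?N" using fin ne bd by auto
  have "0 \<le> Max ?N" using Max_in[OF fin ne] by auto
  then have "Max ?N / Min ?N \<le> Max ?N / l" using mn l by (intro divide_left_mono) auto
  also have "\<dots> < r / l" using mx l by (simp add: divide_strict_right_mono)
  finally show ?thesis unfolding eig_cond_def .
qed

text \<open>With \<open>s = sqrt \<eta>\<close> and \<open>W\<close> the inverse of \<open>K\<close>, expanding \<open>(M \<plusminus> s K) W (M \<plusminus> s K)\<close> gives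
  \<open>S \<plusminus> 2 s M\<close>. The plus sign shows \<open>P = S + 2 s M\<close>, hence \<open>S < P\<close>; the minus sign gives a
  positive semidefinite matrix equal to \<open>2 S - P\<close>, hence \<open>P \<le> 2 S\<close>. All Rayleigh quotients of
  \<open>S\<close> against \<open>P\<close> therefore lie in \<open>[1/2, 1)\<close>.\<close>

lemma preconditioned_schur_complement:
  assumes M: "spd_mat n M" and K: "spd_mat n K" and n: "0 < n" and eta: "\<eta> > 0"
    and S: "S = \<eta> \<cdot>\<^sub>m K + M * inv_mat K * M"
    and P: "P = (M + sqrt \<eta> \<cdot>\<^sub>m K) * inv_mat K * (M + sqrt \<eta> \<cdot>\<^sub>m K)"
  shows "invertible_mat P \<and> invertible_mat (inv_mat P * S) \<and>
         complex_spectrum (inv_mat P * S) \<subseteq> \<real> \<and> eig_cond (inv_mat P * S) < 2"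
proof -
  define s where "s = sqrt \<eta>"
  have s: "s > 0" "s * s = \<eta>" using eta by (auto simp: s_def)
  define W where "W = inv_mat K"
  have W: "spd_mat n W" unfolding W_def by (rule spd_mat_inv_mat[OF K])
  note cM = spd_matD(1)[OF M] and cK = spd_matD(1)[OF K] and cW = spd_matD(1)[OF W]
  note sM = spd_matD(2)[OF M] and sK = spd_matD(2)[OF K] and sW = spd_matD(2)[OF W]
  define X where "X = M + s \<cdot>\<^sub>m K"
  have X: "spd_mat n X" unfolding X_def by (rule spd_mat_add_smult[OF M K s(1)])
  note cX = spd_matD(1)[OF X] and sX = spd_matD(2)[OF X]
  have P': "P = X * W * X" and S': "S = \<eta> \<cdot>\<^sub>m K + M * W * M"
    by (simp_all add: P S X_def W_def s_def)
  have cS: "S \<in> carrier_mat n n" and cP: "P \<in> carrier_mat n n"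
    unfolding S' P' using cM cK cW cX by auto
  have sS: "transpose_mat S = S" and sP: "transpose_mat P = P"
    unfolding S' P' using cM cK cW cX sM sK sW sX
    by (simp_all add: transpose_add[of _ n n] transpose_smult_mat transpose_mult[of _ n n _ n]
        assoc_mult_mat[of _ n n _ n _ n])
  have q: "scalar_prod x (P *\<^sub>v x) = scalar_prod x (S *\<^sub>v x) + 2 * s * scalar_prod x (M *\<^sub>v x)"
      "scalar_prod x (P *\<^sub>v x) \<le> 2 * scalar_prod x (S *\<^sub>v x)"
    if x: "x \<in> carrier_vec n" for x
  proof -
    define a where "a = M *\<^sub>v x"
    define b where "b = K *\<^sub>v x"
    have ca: "a \<in> carrier_vec n" and cb: "b \<in> carrier_vec n"
      using cM cK x by (auto simp: a_def b_def)
    have Wb: "W *\<^sub>v b = x"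
      unfolding b_def W_def using spd_mat_inverse[OF K K] x cK by (simp flip: assoc_mult_mat_vec)
    have cWa: "W *\<^sub>v a \<in> carrier_vec n" using cW ca by simp
    have xa: "scalar_prod a x = scalar_prod x a" and xb: "scalar_prod b x = scalar_prod x b"
      using x ca cb by (auto intro: comm_scalar_prod)
    have bWa: "scalar_prod b (W *\<^sub>v a) = scalar_prod x a"
      using symmetric_mat_scalar_prod[OF cW sW cb ca] Wb by simp
    (* at t = s this is the form of P, at t = - s that of 2 S - P *)
    have form: "scalar_prod (a + t \<cdot>\<^sub>v b) (W *\<^sub>v (a + t \<cdot>\<^sub>v b))
        = scalar_prod a (W *\<^sub>v a) + 2 * t * scalar_prod x a + t * t * scalar_prod x b" for t
      using ca cb cW cWa x
      by (simp add: mult_add_distrib_mat_vec[of _ n n] mult_mat_vec[of _ n n] Wb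
          add_scalar_prod_distrib[of _ n] scalar_prod_add_distrib[of _ n] xa xb bWa
          algebra_simps)
    have "X *\<^sub>v x = a + s \<cdot>\<^sub>v b"
      unfolding X_def a_def b_def using cM cK x
      by (simp add: add_mult_distrib_mat_vec[of _ n n] smult_mult_mat_vec[of _ n])
    then have p: "scalar_prod x (P *\<^sub>v x)
        = scalar_prod a (W *\<^sub>v a) + 2 * s * scalar_prod x a + \<eta> * scalar_prod x b"
      unfolding P' sandwich_mat[OF cX sX cW x] using form[of s] s(2) by simp
    have "scalar_prod x ((\<eta> \<cdot>\<^sub>m K + Y) *\<^sub>v x) = \<eta> * scalar_prod x b + scalar_prod x (Y *\<^sub>v x)"
      if "Y \<in> carrier_mat n n" for Y
      unfolding b_def using that cK x
      by (simp add: add_mult_distrib_mat_vec[of _ n n] smult_mult_mat_vec[of _ n]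
          scalar_prod_add_distrib[of _ n])
    then have "scalar_prod x (S *\<^sub>v x) = \<eta> * scalar_prod x b + scalar_prod x ((M * W * M) *\<^sub>v x)"
      unfolding S' using cM cW by simp
    also have "\<dots> = \<eta> * scalar_prod x b + scalar_prod a (W *\<^sub>v a)"
      unfolding sandwich_mat[OF cM sM cW x] a_def ..
    finally have q: "scalar_prod x (S *\<^sub>v x) = \<eta> * scalar_prod x b + scalar_prod a (W *\<^sub>v a)" .
    show "scalar_prod x (P *\<^sub>v x) = scalar_prod x (S *\<^sub>v x) + 2 * s * scalar_prod x (M *\<^sub>v x)"
      unfolding p q by (simp add: a_def)
    have "0 \<le> scalar_prod (a + (- s) \<cdot>\<^sub>v b) (W *\<^sub>v (a + (- s) \<cdot>\<^sub>v b))"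
      using spd_mat_nonneg[OF W] ca cb by simp
    then show "scalar_prod x (P *\<^sub>v x) \<le> 2 * scalar_prod x (S *\<^sub>v x)"
      unfolding form[of "- s"] p q using s(2) by simp
  qed
  have bd: "0 < scalar_prod x (P *\<^sub>v x) \<and> scalar_prod x (S *\<^sub>v x) < scalar_prod x (P *\<^sub>v x) \<and>
      0 < scalar_prod x (S *\<^sub>v x)"
    if x: "x \<in> carrier_vec n" "x \<noteq> 0\<^sub>v n" for x
  proof -
    have "0 < 2 * s * scalar_prod x (M *\<^sub>v x)" using spd_matD(3)[OF M x] s by simp
    then show ?thesis using q[OF x(1)] by linarith
  qed
  have spP: "spd_mat n P" and spS: "spd_mat n S"
    using cP sP cS sS bd by (auto simp: spd_mat_def)
  note Q = spd_mat_inverse[OF spP spP] and R = spd_mat_inverse[OF spS spS]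
  have cZ: "inv_mat P * S \<in> carrier_mat n n" using Q(1) cS by simp
  have "(inv_mat P * S) * (inv_mat S * P) = inv_mat P * (S * inv_mat S) * P"
    using Q(1) R(1) cS cP by (simp add: assoc_mult_mat[of _ n n _ n _ n])
  moreover have "(inv_mat S * P) * (inv_mat P * S) = inv_mat S * (P * inv_mat P) * S"
    using Q(1) R(1) cS cP by (simp add: assoc_mult_mat[of _ n n _ n _ n])
  ultimately have "invertible_mat (inv_mat P * S)"
    using Q R cS cP by (intro invertible_matI[OF cZ, of "inv_mat S * P"]) auto
  moreover have ev: "z \<in> \<real> \<and> 1/2 \<le> cmod z \<and> cmod z < 1"
    if "z \<in> complex_spectrum (inv_mat P * S)" for z
  proof -
    from pencil_eigenvalue_real[OF spP cS sS that] obtain x where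
      x: "x \<in> carrier_vec n" "x \<noteq> 0\<^sub>v n" and z: "z \<in> \<real>"
      and e: "scalar_prod x (S *\<^sub>v x) = Re z * scalar_prod x (P *\<^sub>v x)" by blast
    let ?p = "scalar_prod x (P *\<^sub>v x)"
    have "0 < ?p" "Re z * ?p < 1 * ?p" "1/2 * ?p \<le> Re z * ?p"
      using bd[OF x] q(2)[OF x(1)] e by auto
    then have "1/2 \<le> Re z" "Re z < 1"
      using mult_less_cancel_right_pos mult_le_cancel_right_pos by blast+
    moreover from z have "cmod z = \<bar>Re z\<bar>" by (auto elim: Reals_cases)
    ultimately show ?thesis using z by simp
  qed
  moreover have "eig_cond (inv_mat P * S) < 1 / (1/2)"
    by (rule eig_cond_bound[OF cZ n]) (use ev in auto)
  ultimately show ?thesis using spd_mat_invertible[OF spP] by auto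
qed

section \<open>Gradients of piecewise linear functions\<close>

lemma gradient_eqI:
  assumes "GDERIV f x :> D"
  shows "gradient f x = D"
  unfolding gradient_def
proof (rule the_equality[where P = "\<lambda>D. GDERIV f x :> D", OF assms])
  fix E assume "GDERIV f x :> E"
  then have "(\<lambda>h. inner h E) = (\<lambda>h. inner h D)"
    using assms unfolding gderiv_def by (rule has_derivative_unique)
  then have "inner h E = inner h D" for h by metis
  then show "E = D" by (metis inner_commute vector_eq_ldot)
qed

text \<open>Only interior points qualify: on an edge a piecewise linear function is in general not
  differentiable.\<close>

lemma GDERIV_affine_on:
  fixes T :: "'a::real_inner set"
  assumes "\<forall>x\<in>T. v x = inner a x + b" "x \<in> interior T"
  shows "GDERIV v x :> a"
proof -
  have "((\<lambda>x. inner a x + b) has_derivative (\<lambda>h. inner h a)) (at x)"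
    by (auto intro!: derivative_eq_intros simp: inner_commute)
  then have "(v has_derivative (\<lambda>h. inner h a)) (at x)"
    by (rule has_derivative_transform_within_open[OF _ open_interior assms(2)])
      (use assms(1) interior_subset in force)
  then show ?thesis by (simp add: gderiv_def)
qed

text \<open>Nondegeneracy of the triangles: a piecewise constant gradient that vanishes almost everywhere
  then vanishes on every triangle.\<close>

lemma triangle_interior_nonempty:
  fixes T :: "(real \<times> real) set"
  assumes "2 simplex T"
  shows "interior T \<noteq> {}"
proof -
  have "aff_dim T = DIM(real \<times> real)" using aff_dim_simplex[OF assms] by simp
  then have "affine hull T = UNIV" using aff_dim_lt_full[of T] by auto
  moreover have "T \<noteq> {}" "convex T" using assms by (auto simp: simplex_def)
  ultimately show ?thesis
    using rel_interior_interior rel_interior_eq_empty by metis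
qed

section \<open>Triangulations of the square\<close>

lemma closure_Omega: "closure Omega = {0..1} \<times> {0..1}"
  unfolding Omega_def by (simp add: closure_Times)

lemma open_Omega: "open Omega"
  unfolding Omega_def by (intro open_Times) auto

lemma emeasure_Omega_finite: "emeasure lebesgue Omega < \<infinity>"
proof -
  have "bounded (closure Omega)"
    unfolding closure_Omega by (intro bounded_Times) auto
  then have "Omega \<in> lmeasurable"
    using open_Omega bounded_subset closure_subset by (blast intro: lmeasurable_open)
  then show ?thesis unfolding fmeasurable_def infinity_ennreal_def by blast
qed

lemma interior_square_Omega: "interior (closure Omega) = Omega"
  unfolding closure_Omega by (simp add: interior_Times Omega_def)

lemma
  assumes T: "triangulation_of \<T> Omega"
  shows finite_triangulation: "finite \<T>"
    and triangulation_Union: "\<Union>\<T> = closure Omega"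
    and triangle: "T \<in> \<T> \<Longrightarrow> 2 simplex T"
    and triangle_subset: "T \<in> \<T> \<Longrightarrow> T \<subseteq> closure Omega"
  using T by (auto simp: triangulation_of_def triangulation_def)

lemma interior_triangle_Omega:
  assumes "triangulation_of \<T> Omega" "T \<in> \<T>"
  shows "interior T \<subseteq> Omega"
  using interior_mono[OF triangle_subset[OF assms]] by (simp add: interior_square_Omega)

text \<open>Triangles are convex, so their frontiers are null sets, and there are finitely many. Hence the
  unspecified gradient values on the edges are invisible to the integrals.\<close>

lemma AE_triangle_interior:
  assumes T: "triangulation_of \<T> Omega"
  shows "AE x in lebesgue. x \<in> Omega \<longrightarrow> (\<exists>T\<in>\<T>. x \<in> interior T)"
proof -
  have "negligible (\<Union>T\<in>\<T>. frontier T)"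
    using finite_triangulation[OF T] triangle[OF T]
    by (auto intro!: negligible_Union negligible_convex_frontier simp: simplex_def)
  then have "AE x in lebesgue. x \<notin> (\<Union>T\<in>\<T>. frontier T)"
    unfolding negligible_iff_null_sets by (rule AE_not_in)
  then show ?thesis
  proof (rule AE_mp, intro AE_I2 impI)
    fix x assume x: "x \<notin> (\<Union>T\<in>\<T>. frontier T)" "x \<in> Omega"
    then obtain S where S: "S \<in> \<T>" "x \<in> S"
      using triangulation_Union[OF T] closure_subset[of Omega] by blast
    with x(1) have "x \<in> interior S"
      using closure_subset[of S] by (auto simp: frontier_def)
    with S show "\<exists>T\<in>\<T>. x \<in> interior T" by blast
  qed
qed

section \<open>The piecewise linear space\<close>

lemma P1_space_sum:
  assumes "\<And>i. i \<in> I \<Longrightarrow> f i \<in> P1_space \<T>"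
  shows "(\<lambda>x. \<Sum>i\<in>I. c i * f i x) \<in> P1_space \<T>"
  unfolding P1_space_def
proof (intro CollectI conjI ballI)
  show "continuous_on (\<Union>\<T>) (\<lambda>x. \<Sum>i\<in>I. c i * f i x)"
    using assms by (auto simp: P1_space_def intro!: continuous_intros)
  fix T assume T: "T \<in> \<T>"
  have "\<forall>i\<in>I. \<exists>a b. \<forall>x\<in>T. f i x = inner a x + b"
    using assms T by (auto simp: P1_space_def)
  then obtain a b where ab: "\<And>i x. i \<in> I \<Longrightarrow> x \<in> T \<Longrightarrow> f i x = inner (a i) x + b i"
    by metis
  show "\<exists>a b. \<forall>x\<in>T. (\<Sum>i\<in>I. c i * f i x) = inner a x + b"
    by (rule exI[of _ "\<Sum>i\<in>I. c i *\<^sub>R a i"], rule exI[of _ "\<Sum>i\<in>I. c i * b i"])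
      (simp add: ab inner_sum_left distrib_left sum.distrib)
qed

lemma P1_GDERIV:
  assumes "v \<in> P1_space \<T>" "T \<in> \<T>"
  obtains a where "\<And>x. x \<in> interior T \<Longrightarrow> GDERIV v x :> a"
proof -
  obtain a b where "\<forall>x\<in>T. v x = inner a x + b"
    using assms unfolding P1_space_def by blast
  from GDERIV_affine_on[OF this] that show thesis by blast
qed

lemma GDERIV_sum:
  assumes "\<And>i. i \<in> I \<Longrightarrow> GDERIV (f i) x :> D i"
  shows "GDERIV (\<lambda>x. \<Sum>i\<in>I. c i * f i x) x :> (\<Sum>i\<in>I. c i *\<^sub>R D i)"
proof -
  have "((\<lambda>x. \<Sum>i\<in>I. c i * f i x) has_derivative (\<lambda>h. \<Sum>i\<in>I. c i * inner h (D i))) (at x)"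
    using assms unfolding gderiv_def
    by (intro has_derivative_sum has_derivative_mult_right) auto
  then show ?thesis by (simp add: gderiv_def inner_sum_right)
qed

lemma P1_gradient_sum:
  assumes T: "triangulation_of \<T> Omega" and f: "\<And>i. i \<in> I \<Longrightarrow> f i \<in> P1_space \<T>"
  shows "AE x in lebesgue. x \<in> Omega \<longrightarrow>
    gradient (\<lambda>x. \<Sum>i\<in>I. c i * f i x) x = (\<Sum>i\<in>I. c i *\<^sub>R gradient (f i) x)"
  using AE_triangle_interior[OF T]
proof (rule AE_mp, intro AE_I2 impI)
  fix x assume "x \<in> Omega \<longrightarrow> (\<exists>T\<in>\<T>. x \<in> interior T)" "x \<in> Omega"
  then obtain S where S: "S \<in> \<T>" "x \<in> interior S" by blast
  have "GDERIV (f i) x :> gradient (f i) x" if "i \<in> I" for i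
    using P1_GDERIV[OF f[OF that] S(1)] S(2) gradient_eqI by metis
  from gradient_eqI[OF GDERIV_sum[OF this]]
  show "gradient (\<lambda>x. \<Sum>i\<in>I. c i * f i x) x = (\<Sum>i\<in>I. c i *\<^sub>R gradient (f i) x)" .
qed

text \<open>The integrand is constant on the interior of each triangle, so its restriction to the union
  \<open>U\<close> of these interiors is measurable piece by piece and bounded. The rest of the square is a null
  set, on which nothing is known about the gradients; measurability there comes from the
  completeness of Lebesgue measure.\<close>

lemma P1_gradient_integrable:
  assumes T: "triangulation_of \<T> Omega" and v: "v \<in> P1_space \<T>" and w: "w \<in> P1_space \<T>"
  shows "set_integrable lebesgue Omega (\<lambda>x. inner (gradient v x) (gradient w x))"
proof -
  define U where "U = (\<Union>T\<in>\<T>. interior T)"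
  define g where "g x = indicator U x *\<^sub>R inner (gradient v x) (gradient w x)" for x
  have "\<forall>T\<in>\<T>. \<exists>k. \<forall>x\<in>interior T. inner (gradient v x) (gradient w x) = k"
    using P1_GDERIV[OF v] P1_GDERIV[OF w] gradient_eqI by metis
  then obtain k where k: "\<And>T x. T \<in> \<T> \<Longrightarrow> x \<in> interior T \<Longrightarrow>
      inner (gradient v x) (gradient w x) = k T" by metis
  have U: "U \<subseteq> Omega" using interior_triangle_Omega[OF T] by (auto simp: U_def)
  have opU: "open U" by (auto simp: U_def)
  define B where "B = (\<Sum>T\<in>\<T>. \<bar>k T\<bar>)"
  have bd: "norm (g x) \<le> B" for x
  proof (cases "x \<in> U")
    case True
    then obtain S where S: "S \<in> \<T>" "x \<in> interior S" by (auto simp: U_def)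
    then have "norm (g x) = \<bar>k S\<bar>" using True by (simp add: g_def k)
    also have "\<dots> \<le> B"
      unfolding B_def using S finite_triangulation[OF T] by (intro member_le_sum) auto
    finally show ?thesis .
  qed (simp add: g_def B_def sum_nonneg)
  have meas: "g \<in> borel_measurable lebesgue"
  proof (rule measurable_piecewise_restrict[where C = "insert (- U) (interior ` \<T>)"])
    show "countable (insert (- U) (interior ` \<T>))"
      using finite_triangulation[OF T] by (simp add: countable_finite)
    show "A \<inter> space lebesgue \<in> sets lebesgue" if "A \<in> insert (- U) (interior ` \<T>)" for A
      using that opU by (auto intro: borel_open borel_closed)
    show "space lebesgue \<subseteq> \<Union> (insert (- U) (interior ` \<T>))" by (auto simp: U_def)
    show "g \<in> borel_measurable (restrict_space lebesgue A)"
      if A: "A \<in> insert (- U) (interior ` \<T>)" for A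
    proof -
      obtain c where c: "\<And>x. x \<in> A \<Longrightarrow> g x = c"
      proof (cases "A = - U")
        case True
        then show thesis using that[of 0] by (auto simp: g_def)
      next
        case False
        then obtain S where S: "S \<in> \<T>" "A = interior S" using A by blast
        then have "g x = k S" if "x \<in> A" for x
        proof -
          have "x \<in> U" using S that by (auto simp: U_def)
          then show ?thesis using S that k[of S x] by (simp add: g_def)
        qed
        then show thesis using that by blast
      qed
      have "(\<lambda>x. c) \<in> borel_measurable (restrict_space lebesgue A)" by simp
      then show ?thesis
        by (rule subst[OF measurable_cong, rotated]) (auto simp: c space_restrict_space)
    qed
  qed
  have "set_integrable lebesgue Omega g"
    unfolding set_integrable_def
  proof (rule integrableI_bounded_set[where A = Omega and B = B])
    show "Omega \<in> sets lebesgue" using open_Omega by (auto intro: borel_open)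
    show "emeasure lebesgue Omega < \<infinity>" by (rule emeasure_Omega_finite)
    show "(\<lambda>x. indicat_real Omega x *\<^sub>R g x) \<in> borel_measurable lebesgue"
      using meas open_Omega by (intro borel_measurable_scaleR borel_measurable_indicator) (auto intro: borel_open)
    show "AE x in lebesgue. x \<in> Omega \<longrightarrow> norm (indicat_real Omega x *\<^sub>R g x) \<le> B"
      using bd by simp
    show "AE x in lebesgue. x \<notin> Omega \<longrightarrow> indicat_real Omega x *\<^sub>R g x = 0" by simp
  qed
  then have i: "integrable lebesgue (\<lambda>x. indicat_real Omega x *\<^sub>R g x)"
    by (simp add: set_integrable_def)
  have ae: "AE x in lebesgue. indicat_real Omega x *\<^sub>R g x
      = indicat_real Omega x *\<^sub>R inner (gradient v x) (gradient w x)"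
    using AE_triangle_interior[OF T]
    by (rule AE_mp, intro AE_I2) (auto simp: g_def U_def indicator_def)
  show ?thesis
    unfolding set_integrable_def
    by (rule integrable_cong_AE_imp[OF i borel_measurable_AE[OF _ ae]])
      (use i ae in \<open>auto intro: borel_measurable_integrable elim: AE_mp\<close>)
qed

lemma P1_continuous:
  assumes "triangulation_of \<T> Omega" "v \<in> P1_space \<T>"
  shows "continuous_on (closure Omega) v"
  using assms triangulation_Union[OF assms(1)] by (auto simp: P1_space_def)

lemma compact_square: "compact (closure Omega)"
  unfolding closure_Omega by (intro compact_Times) auto

lemma continuous_on_square_integrable:
  fixes f :: "real \<times> real \<Rightarrow> real"
  assumes "continuous_on (closure Omega) f"
  shows "set_integrable lebesgue Omega f"
proof -
  have "integrable lborel (\<lambda>x. indicator (closure Omega) x *\<^sub>R f x)"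
    by (rule borel_integrable_compact[OF compact_square assms])
  then have "set_integrable lebesgue (closure Omega) f"
    unfolding set_integrable_def
    by (subst integrable_completion) (simp_all only: borel_measurable_integrable)
  then show ?thesis
    by (rule set_integrable_subset) (use open_Omega closure_subset in \<open>auto intro: borel_open\<close>)
qed

text \<open>The integral only sees \<open>f\<close> almost everywhere on the open square. Continuity carries the vanishing
  to the closed square, where the boundary nodes lie.\<close>

lemma square_integral_zero:
  fixes f :: "real \<times> real \<Rightarrow> real"
  assumes f: "continuous_on (closure Omega) f"
    and "(LINT x:Omega|lebesgue. f x * f x) = 0" and x: "x \<in> closure Omega"
  shows "f x = 0"
proof -
  let ?C = "{x \<in> closure Omega. f x = 0}"
  have cl: "closed ?C"
    using continuous_closed_preimage_constant[OF f] by simp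
  have "set_integrable lebesgue Omega (\<lambda>x. f x * f x)"
    by (intro continuous_on_square_integrable continuous_intros f)
  then have "AE x in lebesgue. indicat_real Omega x *\<^sub>R (f x * f x) = 0"
    using assms(2) unfolding set_integrable_def set_lebesgue_integral_def
    by (subst integral_nonneg_eq_0_iff_AE[symmetric]) auto
  then have "AE x\<in>Omega in lebesgue. x \<in> ?C"
    by (rule AE_mp, intro AE_I2) (use closure_subset in auto)
  then have "Omega \<subseteq> ?C"
    using mem_closed_if_AE_lebesgue_open[OF open_Omega cl] by blast
  then have "closure Omega \<subseteq> ?C" using cl by (rule closure_minimal)
  with x show ?thesis by blast
qed

text \<open>A vanishing gradient makes the function constant on each triangle, so it takes finitely many values
  on the square; a continuous function with finite range on a connected set is constant.\<close>

lemma P1_gradient_zero_constant: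
  assumes T: "triangulation_of \<T> Omega" and v: "v \<in> P1_space \<T>"
    and zero: "(LINT x:Omega|lebesgue. inner (gradient v x) (gradient v x)) = 0"
  shows "v constant_on closure Omega"
proof -
  have "AE x in lebesgue. indicat_real Omega x *\<^sub>R inner (gradient v x) (gradient v x) = 0"
    using zero P1_gradient_integrable[OF T v v]
    unfolding set_integrable_def set_lebesgue_integral_def
    by (subst integral_nonneg_eq_0_iff_AE[symmetric]) auto
  then have ae: "AE x in lebesgue. x \<in> Omega \<longrightarrow> gradient v x = 0"
    by (rule AE_mp, intro AE_I2) auto
  have "\<exists>b. \<forall>x\<in>S. v x = b" if S: "S \<in> \<T>" for S
  proof -
    obtain a b where ab: "\<forall>x\<in>S. v x = inner a x + b"
      using v S unfolding P1_space_def by blast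
    obtain y where y: "y \<in> interior S"
      using triangle_interior_nonempty[OF triangle[OF T S]] by blast
    have "AE x\<in>interior S in lebesgue. x \<in> {x. a = 0}"
      using ae by (rule AE_mp, intro AE_I2)
        (use gradient_eqI[OF GDERIV_affine_on[OF ab]] interior_triangle_Omega[OF T S] in auto)
    from mem_closed_if_AE_lebesgue_open[OF open_interior _ this y] have "a = 0"
      by (cases "a = 0") auto
    with ab show ?thesis by auto
  qed
  then obtain b where b: "\<And>S x. S \<in> \<T> \<Longrightarrow> x \<in> S \<Longrightarrow> v x = b S" by metis
  have "v ` closure Omega \<subseteq> b ` \<T>"
    using b triangulation_Union[OF T] by blast
  then have "finite (v ` closure Omega)"
    using finite_triangulation[OF T] finite_subset by blast
  moreover have "connected (closure Omega)"
    unfolding closure_Omega by (intro connected_Times) auto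
  ultimately show ?thesis
    using continuous_finite_range_constant P1_continuous[OF T v] by blast
qed

section \<open>Mass and stiffness as Gram matrices\<close>

lemma
  fixes f :: "'i \<Rightarrow> 'b \<Rightarrow> real"
  assumes "\<And>i. i \<in> I \<Longrightarrow> set_integrable N A (f i)"
  shows set_integrable_sum: "set_integrable N A (\<lambda>x. \<Sum>i\<in>I. f i x)"
    and set_integral_sum: "(LINT x:A|N. \<Sum>i\<in>I. f i x) = (\<Sum>i\<in>I. LINT x:A|N. f i x)"
  using assms
  by (simp_all add: set_integrable_def set_lebesgue_integral_def sum_distrib_left
      Bochner_Integration.integral_sum)

text \<open>Mass and stiffness matrices are both Gram matrices of integrated inner products, of the basis
  functions and of their gradients; their quadratic forms are squared norms of linear combinations.\<close>

lemma
  fixes f :: "nat \<Rightarrow> 'b \<Rightarrow> 'a::real_inner"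
  assumes int: "\<And>i j. i < n \<Longrightarrow> j < n \<Longrightarrow> set_integrable N A (\<lambda>x. inner (f i x) (f j x))"
    and c: "c \<in> carrier_vec n"
  shows gram_integrable: "set_integrable N A
      (\<lambda>x. inner (\<Sum>i<n. vec_index c i *\<^sub>R f i x) (\<Sum>i<n. vec_index c i *\<^sub>R f i x))" (is ?int)
    and gram_quadratic_form:
      "scalar_prod c (Matrix.mat n n (\<lambda>(i, j). LINT x:A|N. inner (f i x) (f j x)) *\<^sub>v c)
    = (LINT x:A|N. inner (\<Sum>i<n. vec_index c i *\<^sub>R f i x) (\<Sum>i<n. vec_index c i *\<^sub>R f i x))"
      (is "scalar_prod c (?G *\<^sub>v c) = _")
proof -
  have expand: "inner (\<Sum>i<n. vec_index c i *\<^sub>R f i x) (\<Sum>j<n. vec_index c j *\<^sub>R f j x)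
      = (\<Sum>i<n. \<Sum>j<n. vec_index c i * (vec_index c j * inner (f i x) (f j x)))" for x
    by (simp add: inner_sum_left inner_sum_right sum_distrib_left)
      (auto intro!: sum.cong simp: inner_commute)
  show ?int
    unfolding expand using int by (intro set_integrable_sum set_integrable_mult_right) auto
  have "(LINT x:A|N. \<Sum>i<n. \<Sum>j<n. vec_index c i * (vec_index c j * inner (f i x) (f j x)))
      = (\<Sum>i<n. \<Sum>j<n. vec_index c i * (vec_index c j * (LINT x:A|N. inner (f i x) (f j x))))"
  proof (subst set_integral_sum)
    show "set_integrable N A (\<lambda>x. \<Sum>j<n. vec_index c i * (vec_index c j * inner (f i x) (f j x)))"
      if "i \<in> {..<n}" for i
      using that int by (intro set_integrable_sum set_integrable_mult_right) auto
    show "(\<Sum>i<n. LINT x:A|N. \<Sum>j<n. vec_index c i * (vec_index c j * inner (f i x) (f j x)))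
        = (\<Sum>i<n. \<Sum>j<n. vec_index c i * (vec_index c j * (LINT x:A|N. inner (f i x) (f j x))))"
      using int by (intro sum.cong refl, subst set_integral_sum) auto
  qed
  also have "\<dots> = scalar_prod c (?G *\<^sub>v c)"
    using c
    by (simp add: scalar_prod_def sum_distrib_left atLeast0LessThan mult.commute)
  finally show "scalar_prod c (?G *\<^sub>v c)
      = (LINT x:A|N. inner (\<Sum>i<n. vec_index c i *\<^sub>R f i x) (\<Sum>i<n. vec_index c i *\<^sub>R f i x))"
    unfolding expand ..
qed

lemma mesh_nodes_closure:
  assumes "triangulation_of \<T> Omega" "p \<in> mesh_nodes \<T>"
  shows "p \<in> closure Omega"
  using assms triangle_subset[OF assms(1)] by (auto simp: mesh_nodes_def extreme_point_of_def)

text \<open>A matrix of size zero would have an empty spectrum, for which the condition number is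
  meaningless. By Krein-Milman, each triangle has a vertex.\<close>

lemma mesh_nodes_nonempty:
  assumes T: "triangulation_of \<T> Omega"
  shows "mesh_nodes \<T> \<noteq> {}"
proof -
  have "(1/2, 1/2) \<in> \<Union>\<T>" unfolding triangulation_Union[OF T] closure_Omega by simp
  then obtain S where S: "S \<in> \<T>" "S \<noteq> {}" by blast
  have "polytope S" by (rule simplex_imp_polytope[OF triangle[OF T S(1)]])
  then obtain p where "p extreme_point_of S"
    using S(2) extreme_point_exists_convex polytope_imp_compact polytope_imp_convex by metis
  with S show ?thesis unfolding mesh_nodes_def by blast
qed

text \<open>The finite element function with coefficient vector \<open>c\<close>.\<close>

definition nodal_sum where
  "nodal_sum \<phi> ps c x = (\<Sum>i<length ps. vec_index c i * \<phi> (ps ! i) x)"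

lemma nodal_sum_P1:
  assumes "set ps = mesh_nodes \<T>" "nodal_basis \<T> \<phi>"
  shows "nodal_sum \<phi> ps c \<in> P1_space \<T>"
proof -
  have "\<phi> (ps ! i) \<in> P1_space \<T>" if "i < length ps" for i
    using assms that nth_mem[OF that] by (auto simp: nodal_basis_def)
  then show ?thesis
    unfolding nodal_sum_def[abs_def] by (intro P1_space_sum) auto
qed

text \<open>The coefficients are the values at the nodes.\<close>

lemma nodal_sum_zero:
  assumes T: "triangulation_of \<T> Omega" and ps: "distinct ps" "set ps = mesh_nodes \<T>"
    and \<phi>: "nodal_basis \<T> \<phi>" and c: "c \<in> carrier_vec (length ps)"
    and zero: "\<And>x. x \<in> closure Omega \<Longrightarrow> nodal_sum \<phi> ps c x = 0"
  shows "c = 0\<^sub>v (length ps)"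
proof (rule eq_vecI)
  fix j assume "j < dim_vec (0\<^sub>v (length ps) :: real Matrix.vec)"
  then have j: "j < length ps" by simp
  have node: "ps ! i \<in> mesh_nodes \<T>" if "i < length ps" for i
    using ps(2) nth_mem[OF that] by simp
  have "nodal_sum \<phi> ps c (ps ! j) = (\<Sum>i<length ps. if i = j then vec_index c i else 0)"
    unfolding nodal_sum_def
  proof (rule sum.cong)
    fix i assume "i \<in> {..<length ps}"
    then have i: "i < length ps" by simp
    show "vec_index c i * \<phi> (ps ! i) (ps ! j) = (if i = j then vec_index c i else 0)"
      using \<phi> node[OF i] node[OF j] nth_eq_iff_index_eq[OF ps(1) i j]
      by (simp add: nodal_basis_def)
  qed simp
  also have "\<dots> = vec_index c j" using j by simp
  finally show "vec_index c j = vec_index (0\<^sub>v (length ps)) j"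
    using zero[OF mesh_nodes_closure[OF T node[OF j]]] j by simp
qed (use c in simp)

lemma mass_quadratic_form:
  assumes T: "triangulation_of \<T> Omega" and ps: "set ps = mesh_nodes \<T>"
    and \<phi>: "nodal_basis \<T> \<phi>" and c: "c \<in> carrier_vec (length ps)"
  shows "scalar_prod c (mass_matrix \<phi> ps *\<^sub>v c)
    = (LINT x:Omega|lebesgue. nodal_sum \<phi> ps c x * nodal_sum \<phi> ps c x)"
proof -
  have P1: "\<phi> (ps ! i) \<in> P1_space \<T>" if "i < length ps" for i
    using \<phi> ps nth_mem[OF that] by (auto simp: nodal_basis_def)
  have "set_integrable lebesgue Omega (\<lambda>x. inner (\<phi> (ps ! i) x) (\<phi> (ps ! j) x))"
    if "i < length ps" "j < length ps" for i j
    by (intro continuous_on_square_integrable continuous_on_inner P1_continuous[OF T] P1 that)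
  from gram_quadratic_form[where f = "\<lambda>i. \<phi> (ps ! i)", OF this c] show ?thesis
    by (simp add: mass_matrix_def nodal_sum_def)
qed

text \<open>The gradient of a linear combination is the combination of the gradients only away from the edges,
  so the two integrands agree almost everywhere.\<close>

lemma stiffness_quadratic_form:
  assumes T: "triangulation_of \<T> Omega" and ps: "set ps = mesh_nodes \<T>"
    and \<phi>: "nodal_basis \<T> \<phi>" and c: "c \<in> carrier_vec (length ps)"
  shows "scalar_prod c (stiffness_matrix \<phi> ps *\<^sub>v c)
    = (LINT x:Omega|lebesgue. inner (gradient (nodal_sum \<phi> ps c) x) (gradient (nodal_sum \<phi> ps c) x))"
proof -
  let ?n = "length ps"
  let ?g = "\<lambda>x. \<Sum>i<?n. vec_index c i *\<^sub>R gradient (\<phi> (ps ! i)) x"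
  let ?u = "nodal_sum \<phi> ps c"
  have P1: "\<phi> (ps ! i) \<in> P1_space \<T>" if "i < ?n" for i
    using \<phi> ps nth_mem[OF that] by (auto simp: nodal_basis_def)
  have int: "set_integrable lebesgue Omega
      (\<lambda>x. inner (gradient (\<phi> (ps ! i)) x) (gradient (\<phi> (ps ! j)) x))"
    if "i < ?n" "j < ?n" for i j
    by (intro P1_gradient_integrable[OF T] P1 that)
  have i1: "set_integrable lebesgue Omega (\<lambda>x. inner (?g x) (?g x))"
    by (rule gram_integrable[OF int c])
  have i2: "set_integrable lebesgue Omega (\<lambda>x. inner (gradient ?u x) (gradient ?u x))"
    by (intro P1_gradient_integrable[OF T] nodal_sum_P1 ps \<phi>)
  have "AE x\<in>Omega in lebesgue. gradient ?u x = ?g x"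
    unfolding nodal_sum_def[abs_def] by (rule P1_gradient_sum[OF T]) (use P1 in auto)
  then have ae: "AE x in lebesgue. indicator Omega x *\<^sub>R inner (?g x) (?g x)
      = indicator Omega x *\<^sub>R inner (gradient ?u x) (gradient ?u x)"
    by (rule AE_mp, intro AE_I2) (simp add: indicator_def)
  have "(LINT x:Omega|lebesgue. inner (?g x) (?g x))
      = (LINT x:Omega|lebesgue. inner (gradient ?u x) (gradient ?u x))"
    using i1 i2 ae unfolding set_lebesgue_integral_def set_integrable_def
    by (intro integral_cong_AE borel_measurable_integrable)
  then show ?thesis
    using gram_quadratic_form[where f = "\<lambda>i. gradient (\<phi> (ps ! i))", OF int c]
    by (simp add: stiffness_matrix_def)
qed

lemma mean_vector_scalar_prod:
  assumes T: "triangulation_of \<T> Omega" and ps: "set ps = mesh_nodes \<T>"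
    and \<phi>: "nodal_basis \<T> \<phi>" and c: "c \<in> carrier_vec (length ps)"
  shows "scalar_prod c (mean_vector \<phi> ps) = (LINT x:Omega|lebesgue. nodal_sum \<phi> ps c x)"
proof -
  have "set_integrable lebesgue Omega (\<phi> (ps ! i))" if "i < length ps" for i
    using \<phi> ps nth_mem[OF that]
    by (auto simp: nodal_basis_def intro!: continuous_on_square_integrable P1_continuous[OF T])
  then show ?thesis
    unfolding nodal_sum_def using c
    by (subst set_integral_sum) (simp_all add: scalar_prod_def mean_vector_def atLeast0LessThan)
qed

lemma outer_product_quadratic_form:
  assumes "m \<in> carrier_vec n" "c \<in> carrier_vec n"
  shows "scalar_prod c (outer_product m m *\<^sub>v c) = (scalar_prod c m)\<^sup>2"
  using assms
  by (simp add: outer_product_def scalar_prod_def power2_eq_square sum_product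
      sum_distrib_left mult.commute mult.left_commute)

lemma mass_matrix_spd:
  assumes T: "triangulation_of \<T> Omega" and ps: "distinct ps" "set ps = mesh_nodes \<T>"
    and \<phi>: "nodal_basis \<T> \<phi>"
  shows "spd_mat (length ps) (mass_matrix \<phi> ps)"
  unfolding spd_mat_def
proof (intro conjI ballI impI)
  show "mass_matrix \<phi> ps \<in> carrier_mat (length ps) (length ps)"
    by (simp add: mass_matrix_def)
  show "transpose_mat (mass_matrix \<phi> ps) = mass_matrix \<phi> ps"
    by (intro eq_matI) (auto simp: mass_matrix_def mult.commute)
  fix c :: "real Matrix.vec" assume c: "c \<in> carrier_vec (length ps)" "c \<noteq> 0\<^sub>v (length ps)"
  let ?u = "nodal_sum \<phi> ps c"
  let ?I = "LINT x:Omega|lebesgue. ?u x * ?u x"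
  have cont: "continuous_on (closure Omega) ?u"
    by (rule P1_continuous[OF T nodal_sum_P1[OF ps(2) \<phi>]])
  have "?I \<noteq> 0"
    using square_integral_zero[OF cont] nodal_sum_zero[OF T ps \<phi> c(1)] c(2) by blast
  moreover have "0 \<le> ?I" by (simp add: set_lebesgue_integral_def)
  ultimately show "0 < scalar_prod c (mass_matrix \<phi> ps *\<^sub>v c)"
    unfolding mass_quadratic_form[OF T ps(2) \<phi> c(1)] by simp
qed

text \<open>The form is the squared gradient norm of the finite element function plus the square of its mean.
  The first term vanishes only for constants, which the second detects. For a constant \<open>k\<close> with zero
  mean, the integral of its square is \<open>k\<close> times the mean, so the function vanishes.\<close>

lemma stabilized_stiffness_spd:
  assumes T: "triangulation_of \<T> Omega" and ps: "distinct ps" "set ps = mesh_nodes \<T>"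
    and \<phi>: "nodal_basis \<T> \<phi>"
  shows "spd_mat (length ps)
    (stiffness_matrix \<phi> ps + outer_product (mean_vector \<phi> ps) (mean_vector \<phi> ps))"
    (is "spd_mat ?n (?K + ?E)")
  unfolding spd_mat_def
proof (intro conjI ballI impI)
  have m: "mean_vector \<phi> ps \<in> carrier_vec ?n" by (simp add: mean_vector_def)
  have cK: "?K \<in> carrier_mat ?n ?n" by (simp add: stiffness_matrix_def)
  have cE: "?E \<in> carrier_mat ?n ?n" using m by (simp add: outer_product_def)
  show "?K + ?E \<in> carrier_mat ?n ?n" using cE by simp
  show "transpose_mat (?K + ?E) = ?K + ?E"
    by (intro eq_matI) (auto simp: stiffness_matrix_def outer_product_def mean_vector_def
        mult.commute inner_commute)
  fix c :: "real Matrix.vec" assume c: "c \<in> carrier_vec ?n" "c \<noteq> 0\<^sub>v ?n"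
  let ?u = "nodal_sum \<phi> ps c"
  let ?I = "LINT x:Omega|lebesgue. inner (gradient ?u x) (gradient ?u x)"
  let ?J = "LINT x:Omega|lebesgue. ?u x"
  have P1: "?u \<in> P1_space \<T>" by (rule nodal_sum_P1[OF ps(2) \<phi>])
  have form: "scalar_prod c ((?K + ?E) *\<^sub>v c) = ?I + ?J\<^sup>2"
    using cK cE c(1) stiffness_quadratic_form[OF T ps(2) \<phi> c(1)]
      outer_product_quadratic_form[OF m c(1)] mean_vector_scalar_prod[OF T ps(2) \<phi> c(1)]
    by (simp add: add_mult_distrib_mat_vec[of _ ?n ?n] scalar_prod_add_distrib[of _ ?n])
  have I: "0 \<le> ?I" by (simp add: set_lebesgue_integral_def)
  have "?I + ?J\<^sup>2 \<noteq> 0"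
  proof
    assume "?I + ?J\<^sup>2 = 0"
    then have z: "?I = 0" "?J = 0" using I by (auto simp: add_nonneg_eq_0_iff)
    from P1_gradient_zero_constant[OF T P1 z(1)] obtain k
      where k: "\<And>x. x \<in> closure Omega \<Longrightarrow> ?u x = k" by (auto simp: constant_on_def)
    have "(LINT x:Omega|lebesgue. ?u x * ?u x) = (LINT x:Omega|lebesgue. k * ?u x)"
      using k closure_subset[of Omega] open_Omega
      by (intro set_lebesgue_integral_cong) (auto intro: borel_open)
    also have "\<dots> = 0" using z(2) by simp
    finally have "?u x = 0" if "x \<in> closure Omega" for x
      using square_integral_zero[OF P1_continuous[OF T P1]] that by blast
    then have "c = 0\<^sub>v ?n" by (rule nodal_sum_zero[OF T ps \<phi> c(1)])
    with c(2) show False by simp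
  qed
  then show "0 < scalar_prod c ((?K + ?E) *\<^sub>v c)"
    unfolding form using I by (smt (verit) zero_le_power2)
qed

section \<open>The condition number of the preconditioned matrix\<close>

theorem corollary5p2:
  fixes \<T> :: "(real \<times> real) set set"
    and \<phi> :: "real \<times> real \<Rightarrow> real \<times> real \<Rightarrow> real"
    and ps :: "(real \<times> real) list"
    and \<eta> :: real
    and M K Kbar S Spre :: "real mat"
    and m :: "real Matrix.vec"
  assumes "triangulation_of \<T> Omega"
    and "distinct ps" and "set ps = mesh_nodes \<T>"
    and "nodal_basis \<T> \<phi>"
    and "\<eta> > 0"
    and "M = mass_matrix \<phi> ps"
    and "K = stiffness_matrix \<phi> ps"
    and "m = mean_vector \<phi> ps"
    and "Kbar = K + outer_product m m"
    and "S = \<eta> \<cdot>\<^sub>m Kbar + M * inv_mat Kbar * M"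
    and "Spre = (M + sqrt \<eta> \<cdot>\<^sub>m Kbar) * inv_mat Kbar * (M + sqrt \<eta> \<cdot>\<^sub>m Kbar)"
  shows "invertible_mat Kbar \<and> invertible_mat Spre \<and> invertible_mat (inv_mat Spre * S) \<and>
         complex_spectrum (inv_mat Spre * S) \<subseteq> \<real> \<and>
         eig_cond (inv_mat Spre * S) < 2"
proof -
  have M: "spd_mat (length ps) M"
    using mass_matrix_spd assms by blast
  have Kbar: "spd_mat (length ps) Kbar"
    using stabilized_stiffness_spd assms by blast
  have "0 < length ps"
    using mesh_nodes_nonempty[OF assms(1)] assms(3) by auto
  with preconditioned_schur_complement[OF M Kbar _ assms(5,10,11)] spd_mat_invertible[OF Kbar]
  show ?thesis by blast
qed

end
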